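(* Let $0<\varepsilon<1$. Suppose $\Pi$ is a distribution over $\mathbb{R}^{m\times n}$ with the property that for any $A\in\mathbb{R}^{n\times d}$ and $b\in\mathbb{R}^n$ (with $n\geq d$), with $x^*=A^\dagger b$ and $x'=(SA)^\dagger Sb$, $$\Pr_{S\sim\Pi}\Big[\,\|x'-x^*\|_2\lesssim\varepsilon\cdot\|A^\dagger\|_2\cdot\|Ax^*-b\|_2\,\Big]\ge\frac{19}{20}.$$ Then $m\gtrsim\min(n,d/\varepsilon^2)$.
   Context: $M^\dagger$ is the Moore–Penrose pseudoinverse; $\|M\|_2$ is the spectral norm. $f\lesssim g$ (resp. $f\gtrsim g$) means $f\le Cg$ (resp. $f\ge Cg$) for an absolute constant $C>0$; the constant in the conclusion may depend on the constant in the hypothesis. *)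

theory Defs
  imports "HOL-Probability.Probability_Measure" "Jordan_Normal_Form.Matrix"
begin

(* The matrix library and HOL-Analysis share some notation; only the former is used here. *)
unbundle no vec_syntax
unbundle no inner_syntax

definition vnorm :: "real Matrix.vec \<Rightarrow> real" where
  "vnorm v = sqrt (v \<bullet> v)"

(* The unit ball rather than the unit sphere, so that the set is nonempty also for zero columns. *)
definition spectral_norm :: "real Matrix.mat \<Rightarrow> real" where
  "spectral_norm M = Sup {vnorm (M *\<^sub>v x) | x. x \<in> carrier_vec (dim_col M) \<and> vnorm x \<le> 1}"

definition is_pseudoinverse :: "real Matrix.mat \<Rightarrow> real Matrix.mat \<Rightarrow> bool" where
  "is_pseudoinverse M X \<longleftrightarrow>
     X \<in> carrier_mat (dim_col M) (dim_row M) \<and>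
     M * X * M = M \<and>
     X * M * X = X \<and>
     transpose_mat (M * X) = M * X \<and>
     transpose_mat (X * M) = X * M"

definition pinv :: "real Matrix.mat \<Rightarrow> real Matrix.mat" where
  "pinv M = (THE X. is_pseudoinverse M X)"

(* The Borel sigma-algebra of the m by n real matrices, obtained by identifying a matrix with the
   family of its entries. *)
definition borel_mat :: "nat \<Rightarrow> nat \<Rightarrow> real Matrix.mat measure" where
  "borel_mat m n =
     vimage_algebra (carrier_mat m n)
       (\<lambda>M. \<lambda>p\<in>{..<m} \<times> {..<n}. M $$ p)
       (PiM ({..<m} \<times> {..<n}) (\<lambda>_. borel))"

definition matrix_distribution :: "nat \<Rightarrow> nat \<Rightarrow> real Matrix.mat measure \<Rightarrow> bool" where
  "matrix_distribution m n \<mu> \<longleftrightarrow> prob_space \<mu> \<and> sets \<mu> = sets (borel_mat m n)"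

(* C is the constant hidden in the error bound. *)
definition l2_regression_guarantee ::
  "real \<Rightarrow> real \<Rightarrow> nat \<Rightarrow> nat \<Rightarrow> real Matrix.mat measure \<Rightarrow> bool" where
  "l2_regression_guarantee C \<epsilon> n d \<mu> \<longleftrightarrow>
     (\<forall>A \<in> carrier_mat n d. \<forall>b \<in> carrier_vec n.
        let x_opt = pinv A *\<^sub>v b in
        measure \<mu> {S \<in> space \<mu>.
            vnorm (pinv (S * A) *\<^sub>v (S *\<^sub>v b) - x_opt)
              \<le> C * (\<epsilon> * spectral_norm (pinv A) * vnorm (A *\<^sub>v x_opt - b))}
          \<ge> 19 / 20)"

end

theory Submission
  imports Defs
begin

text \<open>
  Take for \<open>A\<close> the embedding of \<open>d\<close> coordinates forming a random cyclic interval \<open>T\<close>, and for \<open>b\<close> a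
  vector of random signs, scaled by a large factor \<open>R\<close> on \<open>T\<close>. Then \<open>A\<^sup>\<dagger> = A\<^sup>T\<close>, the residual has
  norm at most \<open>\<surd>n\<close>, and the error is \<open>Y b\<close> with \<open>Y = X - A\<^sup>T\<close>, \<open>X = (S A)\<^sup>\<dagger> S\<close>.

  Let \<open>r\<close> be the rank of the projection \<open>X A = (S A)\<^sup>\<dagger> S A\<close>. On the columns in \<open>T\<close> the squared
  Frobenius norm of \<open>Y\<close> is \<open>d - r\<close>, so the factor \<open>R\<close> makes the error large unless \<open>r \<ge> d / 2\<close>. If \<open>Q\<close>
  is the projection onto the row space of \<open>S\<close>, then \<open>X Q = X\<close>, hence \<open>r = tr (X Q A)\<close> and by
  Cauchy--Schwarz \<open>r\<^sup>2\<close> is at most the squared Frobenius norm of \<open>X\<close> times the sum of the \<open>Q i i\<close> with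
  \<open>i \<in> T\<close>. As \<open>tr Q \<le> m\<close>, that sum is at most \<open>2 d m / n\<close> for half of the intervals \<open>T\<close>, so the
  mean of the squared error is of order at least \<open>d n / m\<close>. By Paley--Zygmund the squared error
  exceeds a quarter of its mean for at least \<open>3/16\<close> of the signs. If \<open>m\<close> is too small, every \<open>S\<close>
  therefore fails on at least \<open>3/32 > 1/20\<close> of the instances, contradicting the guarantee.
\<close>

section \<open>Random signs\<close>

text \<open>A subset \<open>F\<close> of the index set encodes a sign vector, so that averages over
  uniform random signs become finite sums over \<open>Pow I\<close>.\<close>

definition sgn_at :: "'i set \<Rightarrow> 'i \<Rightarrow> real" where
  "sgn_at F i = (if i \<in> F then 1 else - 1)"

lemma sum_Pow_insert:
  assumes "finite I" "x \<notin> I"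
  shows "(\<Sum>F\<in>Pow (insert x I). f F) = (\<Sum>F\<in>Pow I. f F + f (insert x F))"
proof -
  have "inj_on (insert x) (Pow I)" using assms by (auto simp: inj_on_def)
  moreover have "Pow I \<inter> insert x ` Pow I = {}" using assms by auto
  ultimately show ?thesis
    using assms by (simp add: Pow_insert sum.union_disjoint sum.reindex sum.distrib)
qed

lemma sum_sgn_at_insert:
  assumes "finite I" "x \<notin> I" "F \<subseteq> I"
  shows "(\<Sum>i\<in>insert x I. sgn_at F i * v i) = (\<Sum>i\<in>I. sgn_at F i * v i) - v x"
    and "(\<Sum>i\<in>insert x I. sgn_at (insert x F) i * v i) = (\<Sum>i\<in>I. sgn_at F i * v i) + v x"
proof -
  have "(\<Sum>i\<in>I. sgn_at (insert x F) i * v i) = (\<Sum>i\<in>I. sgn_at F i * v i)"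
    using assms by (intro sum.cong) (auto simp: sgn_at_def)
  moreover have "x \<notin> F" using assms by auto
  ultimately show "(\<Sum>i\<in>insert x I. sgn_at F i * v i) = (\<Sum>i\<in>I. sgn_at F i * v i) - v x"
    and "(\<Sum>i\<in>insert x I. sgn_at (insert x F) i * v i) = (\<Sum>i\<in>I. sgn_at F i * v i) + v x"
    using assms by (simp_all add: sgn_at_def)
qed

text \<open>Induction on \<open>I\<close>: the two signs of a new index \<open>x\<close> turn each
  inner sum \<open>s\<close> into \<open>s - v a x\<close> and \<open>s + v a x\<close>, and the
  cross terms cancel by the parallelogram identity.\<close>

lemma sum_random_signs_second_moment:
  assumes "finite I"
  shows "(\<Sum>F\<in>Pow I. \<Sum>a\<in>D. (\<Sum>i\<in>I. sgn_at F i * v a i)\<^sup>2)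
    = 2 ^ card I * (\<Sum>a\<in>D. \<Sum>i\<in>I. (v a i)\<^sup>2)"
  using assms
proof (induction I)
  case (insert x I)
  let ?s = "\<lambda>F a. \<Sum>i\<in>I. sgn_at F i * v a i"
  have "(\<Sum>F\<in>Pow (insert x I). \<Sum>a\<in>D. (\<Sum>i\<in>insert x I. sgn_at F i * v a i)\<^sup>2)
      = (\<Sum>F\<in>Pow I. (\<Sum>a\<in>D. (?s F a - v a x)\<^sup>2) + (\<Sum>a\<in>D. (?s F a + v a x)\<^sup>2))"
    unfolding sum_Pow_insert[OF insert.hyps]
    by (intro sum.cong refl arg_cong2[where f = "(+)"])
       (use insert.hyps in \<open>simp_all add: sum_sgn_at_insert del: sum.insert\<close>)
  also have "\<dots> = (\<Sum>F\<in>Pow I. 2 * (\<Sum>a\<in>D. (?s F a)\<^sup>2) + 2 * (\<Sum>a\<in>D. (v a x)\<^sup>2))"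
    by (intro sum.cong refl)
       (simp add: sum_distrib_left flip: sum.distrib, intro sum.cong, auto simp: power2_eq_square algebra_simps)
  also have "\<dots> = 2 * (2 ^ card I * (\<Sum>a\<in>D. \<Sum>i\<in>I. (v a i)\<^sup>2)) + 2 ^ card I * (2 * (\<Sum>a\<in>D. (v a x)\<^sup>2))"
    using insert.hyps by (simp add: sum.distrib flip: sum_distrib_left insert.IH) (simp add: card_Pow)
  also have "\<dots> = 2 ^ card (insert x I) * (\<Sum>a\<in>D. \<Sum>i\<in>insert x I. (v a i)\<^sup>2)"
    using insert.hyps by (simp add: sum.distrib algebra_simps)
  finally show ?case .
qed simp

text \<open>With \<open>u\<close> the old squared norm, \<open>b\<close> that of the new column and
  \<open>q\<close> their cross term, the average over the new sign is
  \<open>(u + b)\<^sup>2 + 4 * q\<^sup>2\<close>. Cauchy--Schwarz bounds it by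
  \<open>u\<^sup>2 + 6 * u * b + b\<^sup>2\<close>, and the constant 3 reproduces itself because
  \<open>3 * A\<^sup>2 + 6 * A * b + b\<^sup>2 \<le> 3 * (A + b)\<^sup>2\<close>.\<close>

lemma sum_random_signs_fourth_moment:
  assumes "finite I"
  shows "(\<Sum>F\<in>Pow I. (\<Sum>a\<in>D. (\<Sum>i\<in>I. sgn_at F i * v a i)\<^sup>2)\<^sup>2)
    \<le> 2 ^ card I * (3 * (\<Sum>a\<in>D. \<Sum>i\<in>I. (v a i)\<^sup>2)\<^sup>2)"
  using assms
proof (induction I)
  case (insert x I)
  let ?s = "\<lambda>F a. \<Sum>i\<in>I. sgn_at F i * v a i"
  define A where "A = (\<Sum>a\<in>D. \<Sum>i\<in>I. (v a i)\<^sup>2)"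
  define b where "b = (\<Sum>a\<in>D. (v a x)\<^sup>2)"
  have b0: "b \<ge> 0" by (simp add: b_def sum_nonneg)
  have pm: "(\<Sum>a\<in>D. (?s F a - v a x)\<^sup>2)\<^sup>2 + (\<Sum>a\<in>D. (?s F a + v a x)\<^sup>2)\<^sup>2
      \<le> 2 * (\<Sum>a\<in>D. (?s F a)\<^sup>2)\<^sup>2 + 12 * b * (\<Sum>a\<in>D. (?s F a)\<^sup>2) + 2 * b\<^sup>2" for F
  proof -
    define u where "u = (\<Sum>a\<in>D. (?s F a)\<^sup>2)"
    define q where "q = (\<Sum>a\<in>D. ?s F a * v a x)"
    have q: "q\<^sup>2 \<le> u * b"
      unfolding q_def u_def b_def by (rule Cauchy_Schwarz_ineq_sum)
    have "(\<Sum>a\<in>D. (f a - g a)\<^sup>2) = (\<Sum>a\<in>D. (f a)\<^sup>2) + (\<Sum>a\<in>D. (g a)\<^sup>2) - 2 * (\<Sum>a\<in>D. f a * g a)"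
      and "(\<Sum>a\<in>D. (f a + g a)\<^sup>2) = (\<Sum>a\<in>D. (f a)\<^sup>2) + (\<Sum>a\<in>D. (g a)\<^sup>2) + 2 * (\<Sum>a\<in>D. f a * g a)"
      for f g :: "_ \<Rightarrow> real"
      by (simp_all add: power2_diff power2_sum sum.distrib sum_subtractf sum_distrib_left mult.assoc)
    note * = this[of "?s F" "\<lambda>a. v a x", folded u_def q_def b_def]
    have "(u + b - 2 * q)\<^sup>2 + (u + b + 2 * q)\<^sup>2 = 2 * u\<^sup>2 + 4 * (u * b) + 2 * b\<^sup>2 + 8 * q\<^sup>2"
      by (simp add: power2_eq_square algebra_simps)
    also have "\<dots> \<le> 2 * u\<^sup>2 + 12 * b * u + 2 * b\<^sup>2"
      using q by (simp add: algebra_simps)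
    finally show ?thesis unfolding * u_def .
  qed
  have "(\<Sum>F\<in>Pow (insert x I). (\<Sum>a\<in>D. (\<Sum>i\<in>insert x I. sgn_at F i * v a i)\<^sup>2)\<^sup>2)
      = (\<Sum>F\<in>Pow I. (\<Sum>a\<in>D. (?s F a - v a x)\<^sup>2)\<^sup>2 + (\<Sum>a\<in>D. (?s F a + v a x)\<^sup>2)\<^sup>2)"
    unfolding sum_Pow_insert[OF insert.hyps]
    by (intro sum.cong refl arg_cong2[where f = "(+)"])
       (use insert.hyps in \<open>simp_all add: sum_sgn_at_insert del: sum.insert\<close>)
  also have "\<dots> \<le> (\<Sum>F\<in>Pow I. 2 * (\<Sum>a\<in>D. (?s F a)\<^sup>2)\<^sup>2 + 12 * b * (\<Sum>a\<in>D. (?s F a)\<^sup>2) + 2 * b\<^sup>2)"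
    by (intro sum_mono pm)
  also have "\<dots> = 2 * (\<Sum>F\<in>Pow I. (\<Sum>a\<in>D. (?s F a)\<^sup>2)\<^sup>2) + 12 * b * (2 ^ card I * A) + 2 ^ card I * (2 * b\<^sup>2)"
    using insert.hyps unfolding A_def
    by (simp add: sum.distrib card_Pow flip: sum_distrib_left sum_random_signs_second_moment)
  also have "\<dots> \<le> 2 * (2 ^ card I * (3 * A\<^sup>2)) + 12 * b * (2 ^ card I * A) + 2 ^ card I * (2 * b\<^sup>2)"
    using insert.IH by (simp add: A_def)
  also have "\<dots> = 2 ^ card I * (6 * A\<^sup>2 + 12 * b * A + 2 * b\<^sup>2)"
    by (simp add: algebra_simps)
  also have "\<dots> \<le> 2 ^ card I * (2 * (3 * (A + b)\<^sup>2))"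
    using b0 by (intro mult_left_mono) (simp_all add: power2_eq_square algebra_simps)
  also have "A + b = (\<Sum>a\<in>D. \<Sum>i\<in>insert x I. (v a i)\<^sup>2)"
    using insert.hyps by (simp add: A_def b_def sum.distrib)
  finally show ?case using insert.hyps by (simp add: mult_ac)
qed simp

text \<open>The Paley--Zygmund inequality, in the form of the pointwise bound
  \<open>1[t > 1/4] \<ge> (t - 1/4)/2 - t\<^sup>2/16\<close> for the ratio \<open>t\<close> of a variable to its mean.\<close>

lemma random_signs_anticoncentration:
  fixes v :: "'a \<Rightarrow> 'i \<Rightarrow> real"
  assumes "finite I" and E: "0 < (\<Sum>a\<in>D. \<Sum>i\<in>I. (v a i)\<^sup>2)"
  shows "16 * card {F \<in> Pow I. (\<Sum>a\<in>D. (\<Sum>i\<in>I. sgn_at F i * v a i)\<^sup>2)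
                 > (\<Sum>a\<in>D. \<Sum>i\<in>I. (v a i)\<^sup>2) / 4} \<ge> 3 * 2 ^ card I"
proof -
  define E where "E = (\<Sum>a\<in>D. \<Sum>i\<in>I. (v a i)\<^sup>2)"
  define Z where "Z = (\<lambda>F. \<Sum>a\<in>D. (\<Sum>i\<in>I. sgn_at F i * v a i)\<^sup>2)"
  have E0: "E > 0" using E by (simp add: E_def)
  have pw: "(Z F / E - 1 / 4) / 2 - (Z F / E)\<^sup>2 / 16 \<le> (if Z F > E / 4 then 1 else 0)" for F
  proof -
    define t where "t = Z F / E"
    have t: "Z F > E / 4 \<longleftrightarrow> t > 1 / 4" using E0 by (simp add: t_def field_simps)
    have "(t - 1 / 4) / 2 - t\<^sup>2 / 16 = 7 / 8 - (t - 4)\<^sup>2 / 16"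
      by (simp add: power2_eq_square field_simps)
    moreover have "(t - 4)\<^sup>2 / 16 \<ge> 0" "t\<^sup>2 / 16 \<ge> 0" by simp_all
    ultimately have "(t - 1 / 4) / 2 - t\<^sup>2 / 16 \<le> 1" by linarith
    moreover have "(t - 1 / 4) / 2 - t\<^sup>2 / 16 \<le> 0" if "t \<le> 1 / 4"
    proof -
      have "(t - 1 / 4) / 2 \<le> 0" using that by simp
      thus ?thesis using \<open>t\<^sup>2 / 16 \<ge> 0\<close> by linarith
    qed
    ultimately show ?thesis unfolding t t_def[symmetric] by auto
  qed
  have m2: "(\<Sum>F\<in>Pow I. Z F) = 2 ^ card I * E"
    unfolding Z_def E_def by (rule sum_random_signs_second_moment) fact
  have m4: "(\<Sum>F\<in>Pow I. (Z F)\<^sup>2) \<le> 2 ^ card I * (3 * E\<^sup>2)"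
    unfolding Z_def E_def by (rule sum_random_signs_fourth_moment) fact
  \<comment> \<open>The ratio \<open>t\<close> has mean 1 and second moment at most 3, so the
    pointwise bound averages to at least 1/2 - 1/8 - 3/16 = 3/16.\<close>
  have "2 ^ card I * (3 / 16) = 2 ^ card I * E / (2 * E) - 2 ^ card I / 8 - 2 ^ card I * (3 * E\<^sup>2) / (16 * E\<^sup>2)"
    using E0 by (simp add: field_simps)
  also have "\<dots> \<le> (\<Sum>F\<in>Pow I. Z F) / (2 * E) - 2 ^ card I / 8 - (\<Sum>F\<in>Pow I. (Z F)\<^sup>2) / (16 * E\<^sup>2)"
    unfolding m2 using m4 E0 by (intro diff_left_mono divide_right_mono) auto
  also have "\<dots> = (\<Sum>F\<in>Pow I. (Z F / E - 1 / 4) / 2 - (Z F / E)\<^sup>2 / 16)"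
    using assms(1) by (simp add: sum_subtractf diff_divide_distrib sum_divide_distrib power_divide card_Pow mult_ac)
  also have "\<dots> \<le> (\<Sum>F\<in>Pow I. if Z F > E / 4 then 1 else 0)"
    by (intro sum_mono pw)
  also have "\<dots> = real (card {F \<in> Pow I. Z F > E / 4})"
    using assms(1) by (simp add: sum.If_cases Int_def)
  finally have "real (3 * 2 ^ card I) \<le> real (16 * card {F \<in> Pow I. Z F > E / 4})"
    by simp
  thus ?thesis unfolding Z_def E_def of_nat_le_iff .
qed

section \<open>Existence and uniqueness of the pseudoinverse\<close>

lemma mat_assoc:
  fixes A B C :: "'a::semiring_0 mat"
  assumes "dim_col A = dim_row B" "dim_col B = dim_row C"
  shows "A * B * C = A * (B * C)"
  using assms by (intro assoc_mult_mat[of A "dim_row A" "dim_row B" B "dim_row C" C "dim_col C"]) auto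

lemma mat_transpose_mult:
  fixes A B :: "'a::comm_semiring_0 mat"
  assumes "dim_col A = dim_row B"
  shows "(A * B)\<^sup>T = B\<^sup>T * A\<^sup>T"
  using assms by (intro transpose_mult[of A "dim_row A" "dim_row B" B "dim_col B"]) auto

lemma transpose_mult_self_eq_0:
  fixes W :: "real mat"
  assumes "W\<^sup>T * W = 0\<^sub>m (dim_col W) (dim_col W)"
  shows "W = 0\<^sub>m (dim_row W) (dim_col W)"
proof (rule eq_matI)
  fix i j assume ij: "i < dim_row (0\<^sub>m (dim_row W) (dim_col W) :: real mat)" "j < dim_col (0\<^sub>m (dim_row W) (dim_col W) :: real mat)"
  have "(W\<^sup>T * W) $$ (j, j) = 0" using assms ij by auto
  hence "(\<Sum>i<dim_row W. (W $$ (i, j))\<^sup>2) = 0"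
    using ij by (simp add: scalar_prod_def power2_eq_square atLeast0LessThan)
  thus "W $$ (i, j) = 0\<^sub>m (dim_row W) (dim_col W) $$ (i, j)"
    using ij by (subst (asm) sum_nonneg_eq_0_iff) auto
qed auto

text \<open>The difference \<open>W = M * (Y - Z)\<close> satisfies
  \<open>W\<^sup>T * W = (Y - Z)\<^sup>T * (M\<^sup>T * W) = 0\<close>, and the diagonal of
  \<open>W\<^sup>T * W\<close> consists of the squared column norms of \<open>W\<close>.\<close>

lemma transpose_mult_cancel:
  fixes M :: "real mat"
  assumes "dim_row Y = dim_col M" "dim_row Z = dim_col M" "dim_col Y = dim_col Z"
    and "M\<^sup>T * (M * Y) = M\<^sup>T * (M * Z)"
  shows "M * Y = M * Z"
proof -
  let ?N = "Y - Z" and ?W = "M * Y - M * Z"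
  have W: "?W = M * ?N"
    using assms by (intro mult_minus_distrib_mat[symmetric, of M "dim_row M" "dim_col M" Y "dim_col Z" Z]) auto
  have "M\<^sup>T * ?W = M\<^sup>T * (M * Y) - M\<^sup>T * (M * Z)"
    using assms by (intro mult_minus_distrib_mat[of _ "dim_col M" "dim_row M" _ "dim_col Z"]) auto
  also have "\<dots> = 0\<^sub>m (dim_col M) (dim_col Z)"
    using assms by auto
  finally have "?N\<^sup>T * (M\<^sup>T * ?W) = 0\<^sub>m (dim_col Z) (dim_col Z)"
    using assms by (metis carrier_matI index_minus_mat(2,3) index_transpose_mat(2,3) right_mult_zero_mat)
  moreover have "?W\<^sup>T * ?W = ?N\<^sup>T * (M\<^sup>T * ?W)"
    using assms by (simp add: W mat_transpose_mult mat_assoc)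
  ultimately have "?W = 0\<^sub>m (dim_row M) (dim_col Z)"
    using transpose_mult_self_eq_0[of ?W] assms by simp
  hence "\<And>i j. i < dim_row M \<Longrightarrow> j < dim_col Z \<Longrightarrow> ?W $$ (i,j) = 0" by simp
  thus ?thesis using assms by (intro eq_matI) auto
qed

text \<open>Rank-one reduction: subtracting from \<open>M\<close> the multiple of a column times a row through a
  nonzero entry clears that row, and a generalized inverse of the result can be lifted.\<close>

lemma generalized_inverse_exists:
  fixes M :: "real mat"
  assumes "M \<in> carrier_mat r c"
  shows "\<exists>G \<in> carrier_mat c r. M * G * M = M"
  using assms
proof (induction "card {i. i < r \<and> (\<exists>j<c. M $$ (i, j) \<noteq> 0)}" arbitrary: M rule: less_induct)
  case less
  note M = less.prems
  show ?case
  proof (cases "\<exists>i<r. \<exists>j<c. M $$ (i, j) \<noteq> 0")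
    case False
    hence "M = 0\<^sub>m r c" using M by (intro eq_matI) auto
    thus ?thesis by (intro bexI[of _ "0\<^sub>m c r"]) auto
  next
    case True
    then obtain i j where ij: "i < r" "j < c" "M $$ (i, j) \<noteq> 0" by blast
    define p where "p = M $$ (i, j)"
    have p: "p \<noteq> 0" using ij p_def by simp
    define N where "N = mat r c (\<lambda>(k,l). M $$ (k, l) - M $$ (k, j) * M $$ (i, l) / p)"
    have N: "N \<in> carrier_mat r c" by (simp add: N_def)
    \<comment> \<open>The number of nonzero rows drops: zero rows of \<open>M\<close> stay zero in
      \<open>N\<close>, and the pivot row \<open>i\<close> becomes zero.\<close>
    have "{k. k < r \<and> (\<exists>l<c. N $$ (k, l) \<noteq> 0)} \<subset> {k. k < r \<and> (\<exists>l<c. M $$ (k, l) \<noteq> 0)}"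
    proof
      have "N $$ (k, l) = 0" if "k < r" "l < c" "\<And>l. l < c \<Longrightarrow> M $$ (k, l) = 0" for k l
        using that ij by (simp add: N_def)
      thus "{k. k < r \<and> (\<exists>l<c. N $$ (k, l) \<noteq> 0)} \<subseteq> {k. k < r \<and> (\<exists>l<c. M $$ (k, l) \<noteq> 0)}"
        by blast
      have "i \<notin> {k. k < r \<and> (\<exists>l<c. N $$ (k, l) \<noteq> 0)}"
        using ij p by (auto simp: N_def p_def)
      moreover have "i \<in> {k. k < r \<and> (\<exists>l<c. M $$ (k, l) \<noteq> 0)}" using ij by auto
      ultimately show "{k. k < r \<and> (\<exists>l<c. N $$ (k, l) \<noteq> 0)} \<noteq> {k. k < r \<and> (\<exists>l<c. M $$ (k, l) \<noteq> 0)}"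
        by blast
    qed
    hence "card {k. k < r \<and> (\<exists>l<c. N $$ (k, l) \<noteq> 0)} < card {k. k < r \<and> (\<exists>l<c. M $$ (k, l) \<noteq> 0)}"
      by (intro psubset_card_mono) auto
    from less.hyps[OF this N] obtain G where G: "G \<in> carrier_mat c r" "N * G * N = N" by blast
    \<comment> \<open>The single entry \<open>1 / p\<close> sits at the transposed pivot position,
      which makes \<open>M * E * M\<close> exactly the rank-one matrix \<open>M - N\<close>.\<close>
    define E where "E = mat c r (\<lambda>(k,l). if k = j \<and> l = i then 1 / p else 0)"
    have E: "E \<in> carrier_mat c r" by (simp add: E_def)
    have ME: "M * E = mat r r (\<lambda>(k,l). if l = i then M $$ (k,j) / p else 0)"
      using M ij by (intro eq_matI) (auto simp: E_def scalar_prod_def if_distrib[of "\<lambda>x. _ * x"] sum.delta cong: if_cong)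
    have EM: "E * M = mat c c (\<lambda>(k,l). if k = j then M $$ (i,l) / p else 0)"
    proof (rule eq_matI)
      fix k l assume kl: "k < dim_row (mat c c (\<lambda>(k,l). if k = j then M $$ (i,l) / p else 0))"
         "l < dim_col (mat c c (\<lambda>(k,l). if k = j then M $$ (i,l) / p else 0))"
      have "(E * M) $$ (k,l) = (\<Sum>x = 0..<r. E $$ (k,x) * M $$ (x,l))"
        using kl M E by (simp add: scalar_prod_def)
      also have "\<dots> = (\<Sum>x = 0..<r. if x = i then (if k = j then 1/p else 0) * M $$ (i,l) else 0)"
        using kl ij by (intro sum.cong) (auto simp: E_def)
      finally show "(E * M) $$ (k,l) = mat c c (\<lambda>(k,l). if k = j then M $$ (i,l) / p else 0) $$ (k,l)"
        using kl ij by simp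
    qed (use M E in auto)
    have MEM: "M * E * M = M - N"
    proof (rule eq_matI)
      fix k l assume kl: "k < dim_row (M - N)" "l < dim_col (M - N)"
      have "(M * E * M) $$ (k,l) = (\<Sum>x = 0..<r. (M * E) $$ (k,x) * M $$ (x,l))"
        using kl M E N by (simp add: scalar_prod_def del: assoc_mult_mat)
      also have "\<dots> = (\<Sum>x = 0..<r. if x = i then M $$ (k,j) / p * M $$ (i,l) else 0)"
        using kl ij N by (intro sum.cong) (auto simp: ME)
      finally show "(M * E * M) $$ (k,l) = (M - N) $$ (k,l)"
        using kl ij N M by (simp add: N_def del: assoc_mult_mat)
    qed (use M N E in auto)
    \<comment> \<open>Since \<open>M * R = N = L * M\<close>, the lift \<open>R * G * L + E\<close>
      gives \<open>N * G * N + (M - N) = M\<close>.\<close>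
    define R where "R = 1\<^sub>m c - E * M"
    define L where "L = 1\<^sub>m r - M * E"
    have RL: "R \<in> carrier_mat c c" "L \<in> carrier_mat r r"
      using M E by (auto simp: R_def L_def)
    have MmMN: "M - (M - N) = N" using M N by (intro eq_matI) auto
    have MR: "M * R = N"
      using mult_minus_distrib_mat[of M r c "1\<^sub>m c" c "E * M"] M E MEM MmMN by (simp add: R_def)
    have LM: "L * M = N"
      using minus_mult_distrib_mat[of "1\<^sub>m r" r r "M * E" M c] M E MEM MmMN by (simp add: L_def)
    have "M * (R * G * L + E) * M = M * (R * G * L) * M + M * E * M"
      using M E G RL by (simp add: mult_add_distrib_mat[of M r c _ r] add_mult_distrib_mat[of _ r r _ M c])
    also have "M * (R * G * L) * M = (M * R) * G * (L * M)"
      using M G RL by (simp add: mat_assoc)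
    also have "\<dots> = N" by (simp add: MR LM G)
    also have "N + M * E * M = M" unfolding MEM using M N by (intro eq_matI) auto
    finally show ?thesis using M E G RL by (intro bexI[of _ "R * G * L + E"]) auto
  qed
qed

text \<open>Take \<open>K = G * M\<^sup>T\<close> for a generalized inverse \<open>G\<close> of
  \<open>M\<^sup>T * M\<close>. As \<open>G\<^sup>T\<close> is another one, cancelling
  \<open>M\<^sup>T\<close> shows that both \<open>P = M * K\<close> and \<open>P\<^sup>T\<close> fix
  \<open>M\<close>. Hence \<open>P\<^sup>T * P = P\<close>, which forces \<open>P\<close> to be
  symmetric.\<close>

lemma symmetric_right_inverse_exists:
  fixes M :: "real mat"
  assumes "M \<in> carrier_mat r c"
  shows "\<exists>K \<in> carrier_mat c r. M * K * M = M \<and> (M * K)\<^sup>T = M * K"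
proof -
  have "M\<^sup>T * M \<in> carrier_mat c c" using assms by auto
  from generalized_inverse_exists[OF this] obtain G
    where G: "G \<in> carrier_mat c c" and GM: "M\<^sup>T * M * G * (M\<^sup>T * M) = M\<^sup>T * M" by blast
  have GT: "M\<^sup>T * M * G\<^sup>T * (M\<^sup>T * M) = M\<^sup>T * M"
  proof -
    have "(M\<^sup>T * M * G * (M\<^sup>T * M))\<^sup>T = (M\<^sup>T * M)\<^sup>T" unfolding GM ..
    thus ?thesis using assms G by (simp add: mat_transpose_mult mat_assoc)
  qed
  have *: "M * (H * (M\<^sup>T * M)) = M"
    if "H \<in> carrier_mat c c" "M\<^sup>T * M * H * (M\<^sup>T * M) = M\<^sup>T * M" for H
  proof -
    have d: "dim_row H = c" "dim_col H = c" "dim_row M = r" "dim_col M = c"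
      using that(1) assms by auto
    have M1: "M * 1\<^sub>m c = M" using assms by simp
    have "M\<^sup>T * (M * (H * (M\<^sup>T * M))) = M\<^sup>T * M * H * (M\<^sup>T * M)"
      using d by (simp add: mat_assoc)
    hence "M\<^sup>T * (M * (H * (M\<^sup>T * M))) = M\<^sup>T * (M * 1\<^sub>m c)"
      unfolding that(2) M1 .
    hence "M * (H * (M\<^sup>T * M)) = M * 1\<^sub>m c"
      by (rule transpose_mult_cancel[rotated 3]) (simp_all add: d)
    thus ?thesis unfolding M1 .
  qed
  let ?P = "M * G * M\<^sup>T"
  have PM: "?P * M = M" using *[OF G GM] assms G by (simp add: mat_assoc)
  have "M * (G\<^sup>T * (M\<^sup>T * M)) = M" using G by (intro *[OF _ GT]) simp
  hence PT: "?P\<^sup>T * M = M" using assms G by (simp add: mat_assoc mat_transpose_mult)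
  have "?P\<^sup>T * ?P = (?P\<^sup>T * M) * (G * M\<^sup>T)" using assms G by (simp add: mat_assoc)
  also have "\<dots> = ?P" unfolding PT using assms G by (simp add: mat_assoc)
  finally have P: "?P\<^sup>T * ?P = ?P" .
  have "?P\<^sup>T = (?P\<^sup>T * ?P)\<^sup>T" unfolding P ..
  also have "\<dots> = ?P\<^sup>T * ?P" by (subst mat_transpose_mult) auto
  finally have "?P\<^sup>T = ?P" unfolding P .
  thus ?thesis using PM assms G
    by (intro bexI[of _ "G * M\<^sup>T"]) (auto simp: mat_assoc)
qed

text \<open>The previous lemma for \<open>M\<close> gives \<open>K\<close> with \<open>M * K\<close>
  symmetric; applied to the transpose it gives \<open>N\<close> with \<open>N * M\<close> symmetric.
  The product \<open>X = N * (M * K)\<close> inherits both, since \<open>M * X = M * K\<close> and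
  \<open>X * M = N * M\<close>.\<close>

lemma is_pseudoinverse_exists: "\<exists>X. is_pseudoinverse M X"
proof -
  let ?r = "dim_row M" and ?c = "dim_col M"
  obtain K where K: "K \<in> carrier_mat ?c ?r" "M * K * M = M" "(M * K)\<^sup>T = M * K"
    using symmetric_right_inverse_exists[of M ?r ?c] by auto
  obtain L where L: "L \<in> carrier_mat ?r ?c" "M\<^sup>T * L * M\<^sup>T = M\<^sup>T" "(M\<^sup>T * L)\<^sup>T = M\<^sup>T * L"
    using symmetric_right_inverse_exists[of "M\<^sup>T" ?c ?r] by auto
  define N where "N = L\<^sup>T"
  have N: "N \<in> carrier_mat ?c ?r" using L by (simp add: N_def)
  have MNM: "M * (N * M) = M"
  proof -
    have "(M\<^sup>T * L * M\<^sup>T)\<^sup>T = M" using L by simp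
    thus ?thesis using L(1) by (simp add: mat_transpose_mult mat_assoc N_def)
  qed
  have NM: "(N * M)\<^sup>T = N * M"
    using L by (simp add: mat_transpose_mult N_def)
  have MKM: "M * (K * M) = M" using K by (simp add: mat_assoc)
  let ?X = "N * (M * K)"
  have "M * ?X = M * (N * M) * K" using K N by (simp add: mat_assoc)
  hence MX: "M * ?X = M * K" by (simp add: MNM)
  have XM: "?X * M = N * M" using K N by (simp add: mat_assoc MKM)
  have "?X * M * ?X = N * (M * (N * M)) * K" unfolding XM using K N by (simp add: mat_assoc)
  hence "?X * M * ?X = ?X" unfolding MNM using K N by (simp add: mat_assoc)
  hence "is_pseudoinverse M ?X"
    unfolding is_pseudoinverse_def using K N MX XM NM by auto
  thus ?thesis ..
qed

text \<open>Penrose's argument: transposing \<open>M * X = (M * Y) * (M * X)\<close> yields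
  \<open>M * X = M * Y\<close>, and likewise \<open>X * M = Y * M\<close>; then
  \<open>X = X * M * X\<close> can be rewritten into \<open>Y * M * Y = Y\<close>.\<close>

lemma is_pseudoinverse_unique:
  assumes "is_pseudoinverse M X" "is_pseudoinverse M Y"
  shows "X = Y"
proof -
  note d = assms[unfolded is_pseudoinverse_def]
  have c: "dim_row X = dim_col M" "dim_col X = dim_row M" "dim_row Y = dim_col M" "dim_col Y = dim_row M"
    using d by auto
  have MXM: "M * (X * M) = M" and MYM: "M * (Y * M) = M"
    using d c by (metis mat_assoc)+
  have sym: "(M * X)\<^sup>T = M * X" "(X * M)\<^sup>T = X * M" "(M * Y)\<^sup>T = M * Y" "(Y * M)\<^sup>T = Y * M"
    and X: "X * M * X = X" and Y: "Y * M * Y = Y"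
    using d by auto
  have "M * X = (M * X)\<^sup>T" using sym by simp
  also have "\<dots> = (M * (Y * M) * X)\<^sup>T" by (simp add: MYM)
  also have "\<dots> = (M * X)\<^sup>T * (M * Y)\<^sup>T"
    using c by (subst mat_transpose_mult[symmetric]) (auto simp: mat_assoc)
  also have "\<dots> = M * (X * M) * Y" unfolding sym using c by (simp add: mat_assoc)
  also have "\<dots> = M * Y" by (simp add: MXM)
  finally have MXY: "M * X = M * Y" .
  have "X * M = (X * M)\<^sup>T" using sym by simp
  also have "\<dots> = (X * (M * (Y * M)))\<^sup>T" by (simp add: MYM)
  also have "\<dots> = (Y * M)\<^sup>T * (X * M)\<^sup>T"
    using c by (subst mat_transpose_mult[symmetric]) (auto simp: mat_assoc)
  also have "\<dots> = Y * (M * (X * M))" unfolding sym using c by (simp add: mat_assoc)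
  also have "\<dots> = Y * M" by (simp add: MXM)
  finally have XYM: "X * M = Y * M" .
  have "X = X * M * X" using X by simp
  also have "\<dots> = Y * (M * X)" using c by (simp add: XYM mat_assoc)
  also have "\<dots> = Y * M * Y" using c by (simp add: MXY mat_assoc)
  also have "\<dots> = Y" using Y by simp
  finally show ?thesis .
qed

lemma pinv_eqI: "is_pseudoinverse M X \<Longrightarrow> pinv M = X"
  unfolding pinv_def using is_pseudoinverse_unique by (intro the_equality)

lemma is_pseudoinverse_pinv: "is_pseudoinverse M (pinv M)"
  using is_pseudoinverse_exists[of M] pinv_eqI by auto

lemma pinv_carrier: "pinv M \<in> carrier_mat (dim_col M) (dim_row M)"
  and mult_pinv_mult: "M * pinv M * M = M"
  and mult_pinv_symmetric: "(M * pinv M)\<^sup>T = M * pinv M"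
  and pinv_mult_symmetric: "(pinv M * M)\<^sup>T = pinv M * M"
  using is_pseudoinverse_pinv[of M] by (auto simp: is_pseudoinverse_def)

section \<open>Coordinate embeddings\<close>

text \<open>From \<open>P = P * P\<^sup>T\<close>, a diagonal entry is the squared norm of its row.
  That norm includes the square of the entry itself, so the entry is at most 1.\<close>

lemma symmetric_idempotent_diag:
  fixes P :: "real mat"
  assumes P: "P \<in> carrier_mat k k" "P\<^sup>T = P" "P * P = P" and i: "i < k"
  shows "P $$ (i, i) = (\<Sum>j<k. (P $$ (i, j))\<^sup>2)" and "P $$ (i, i) \<le> 1"
proof -
  have sym: "P $$ (j, i) = P $$ (i, j)" if "j < k" for j
  proof -
    have "P\<^sup>T $$ (i, j) = P $$ (j, i)" using P(1) i that by simp
    thus ?thesis using P(2) by simp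
  qed
  have "P $$ (i, i) = (P * P) $$ (i, i)" using P by simp
  also have "\<dots> = (\<Sum>j<k. P $$ (i, j) * P $$ (j, i))"
    using P(1) i by (simp add: scalar_prod_def atLeast0LessThan)
  also have "\<dots> = (\<Sum>j<k. (P $$ (i, j))\<^sup>2)"
    by (intro sum.cong) (simp_all add: sym power2_eq_square)
  finally show eq: "P $$ (i, i) = (\<Sum>j<k. (P $$ (i, j))\<^sup>2)" .
  have "(P $$ (i, i))\<^sup>2 \<le> (\<Sum>j<k. (P $$ (i, j))\<^sup>2)"
    using i by (intro member_le_sum) auto
  hence le: "P $$ (i, i) * P $$ (i, i) \<le> P $$ (i, i)"
    unfolding eq[symmetric] by (simp only: power2_eq_square)
  show "P $$ (i, i) \<le> 1"
  proof (rule ccontr)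
    assume "\<not> P $$ (i, i) \<le> 1"
    hence "P $$ (i, i) * 1 < P $$ (i, i) * P $$ (i, i)" by (intro mult_strict_left_mono) auto
    thus False using le by simp
  qed
qed

text \<open>\<open>pinv S * S\<close> is the orthogonal projection onto the row space of
  \<open>S\<close>.\<close>

lemma pinv_mult_projection:
  assumes "S \<in> carrier_mat m n"
  shows "pinv S * S \<in> carrier_mat n n" "(pinv S * S)\<^sup>T = pinv S * S"
    "(pinv S * S) * (pinv S * S) = pinv S * S" "S * (pinv S * S) = S"
proof -
  have c: "pinv S \<in> carrier_mat n m" using pinv_carrier[of S] assms by simp
  show "pinv S * S \<in> carrier_mat n n" using c assms by simp
  show "(pinv S * S)\<^sup>T = pinv S * S" by (rule pinv_mult_symmetric)
  show "S * (pinv S * S) = S"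
    using mult_pinv_mult[of S] assms c by (simp add: mat_assoc)
  thus "(pinv S * S) * (pinv S * S) = pinv S * S"
    using assms c by (simp add: mat_assoc)
qed

lemma mult_pinv_projection:
  assumes "S \<in> carrier_mat m n"
  shows "S * pinv S \<in> carrier_mat m m" "(S * pinv S)\<^sup>T = S * pinv S"
    "(S * pinv S) * (S * pinv S) = S * pinv S"
proof -
  have c: "pinv S \<in> carrier_mat n m" using pinv_carrier[of S] assms by simp
  show "S * pinv S \<in> carrier_mat m m" using c assms by simp
  show "(S * pinv S)\<^sup>T = S * pinv S" by (rule mult_pinv_symmetric)
  have "(S * pinv S) * (S * pinv S) = S * pinv S * S * pinv S"
    using assms c by (simp add: mat_assoc)
  thus "(S * pinv S) * (S * pinv S) = S * pinv S"
    unfolding mult_pinv_mult .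
qed

text \<open>Cyclicity of the trace passes to the \<open>m\<close> by \<open>m\<close> projection
  \<open>S * pinv S\<close>, whose diagonal entries are at most 1.\<close>

lemma trace_pinv_mult_le:
  assumes "S \<in> carrier_mat m n"
  shows "(\<Sum>i<n. (pinv S * S) $$ (i, i)) \<le> real m"
proof -
  have c: "pinv S \<in> carrier_mat n m" using pinv_carrier[of S] assms by simp
  have "(\<Sum>i<n. (pinv S * S) $$ (i, i)) = (\<Sum>i<n. \<Sum>k<m. pinv S $$ (i, k) * S $$ (k, i))"
    using assms c by (intro sum.cong) (auto simp: scalar_prod_def atLeast0LessThan)
  also have "\<dots> = (\<Sum>k<m. \<Sum>i<n. S $$ (k, i) * pinv S $$ (i, k))"
    by (subst sum.swap) (simp add: mult.commute)
  also have "\<dots> = (\<Sum>k<m. (S * pinv S) $$ (k, k))"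
    using assms c by (intro sum.cong) (auto simp: scalar_prod_def atLeast0LessThan)
  also have "\<dots> \<le> (\<Sum>k<m. 1)"
    by (intro sum_mono symmetric_idempotent_diag(2)[OF mult_pinv_projection[OF assms]]) simp
  finally show ?thesis by simp
qed

section \<open>Embeddings of \<open>d\<close> coordinates, enumerated by \<open>t\<close>, and their
  least squares problems\<close>

definition coord_embedding :: "nat \<Rightarrow> nat \<Rightarrow> (nat \<Rightarrow> nat) \<Rightarrow> real mat" where
  "coord_embedding n d t = mat n d (\<lambda>(i, j). if i = t j then 1 else 0)"

lemma coord_embedding_carrier [simp]: "coord_embedding n d t \<in> carrier_mat n d"
  and coord_embedding_dim [simp]: "dim_row (coord_embedding n d t) = n" "dim_col (coord_embedding n d t) = d"
  by (simp_all add: coord_embedding_def)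

lemma mult_coord_embedding:
  assumes "M \<in> carrier_mat k n" "a < k" "j < d" "t j < n"
  shows "(M * coord_embedding n d t) $$ (a, j) = M $$ (a, t j)"
proof -
  have "(M * coord_embedding n d t) $$ (a, j) = (\<Sum>i = 0..<n. M $$ (a, i) * (if i = t j then 1 else 0))"
    using assms by (simp add: scalar_prod_def coord_embedding_def)
  also have "\<dots> = (\<Sum>i = 0..<n. if i = t j then M $$ (a, i) else 0)"
    by (intro sum.cong) auto
  finally show ?thesis using assms by simp
qed

lemma transpose_coord_embedding_mult_vec:
  assumes "x \<in> carrier_vec n" "j < d" "t j < n"
  shows "((coord_embedding n d t)\<^sup>T *\<^sub>v x) $ j = x $ t j"
proof -
  have "((coord_embedding n d t)\<^sup>T *\<^sub>v x) $ j = (\<Sum>i = 0..<n. (if i = t j then 1 else 0) * x $ i)"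
    using assms by (simp add: scalar_prod_def coord_embedding_def)
  also have "\<dots> = (\<Sum>i = 0..<n. if i = t j then x $ i else 0)"
    by (intro sum.cong) auto
  finally show ?thesis using assms by simp
qed

text \<open>The columns are distinct unit vectors, hence orthonormal, and the Penrose equations
  follow from \<open>?A\<^sup>T * ?A = 1\<^sub>m d\<close>.\<close>

lemma pinv_coord_embedding:
  assumes "inj_on t {..<d}" "t ` {..<d} \<subseteq> {..<n}"
  shows "pinv (coord_embedding n d t) = (coord_embedding n d t)\<^sup>T"
proof -
  let ?A = "coord_embedding n d t"
  have id: "?A\<^sup>T * ?A = 1\<^sub>m d"
  proof (rule eq_matI)
    fix a j assume "a < dim_row (1\<^sub>m d :: real mat)" "j < dim_col (1\<^sub>m d :: real mat)"
    moreover from this have "t j < n" using assms by auto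
    ultimately show "(?A\<^sup>T * ?A) $$ (a, j) = 1\<^sub>m d $$ (a, j)"
      using assms(1) by (subst mult_coord_embedding[of _ d]) (auto simp: coord_embedding_def inj_on_def)
  qed auto
  have AA: "?A * ?A\<^sup>T * ?A = ?A" by (simp add: mat_assoc id)
  have AT: "?A\<^sup>T * ?A * ?A\<^sup>T = ?A\<^sup>T" by (simp add: id)
  show ?thesis
    by (rule pinv_eqI) (simp add: is_pseudoinverse_def AA AT id mat_transpose_mult)
qed

lemma vnorm_eq: "vnorm v = sqrt (\<Sum>i<dim_vec v. (v $ i)\<^sup>2)"
  by (simp add: vnorm_def scalar_prod_def power2_eq_square atLeast0LessThan)

lemma spectral_norm_pinv_coord_embedding_le:
  assumes "inj_on t {..<d}" "t ` {..<d} \<subseteq> {..<n}"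
  shows "spectral_norm (pinv (coord_embedding n d t)) \<le> 1"
  unfolding spectral_norm_def pinv_coord_embedding[OF assms]
proof (rule cSup_least)
  let ?M = "(coord_embedding n d t)\<^sup>T"
  show "{vnorm (?M *\<^sub>v x) |x. x \<in> carrier_vec (dim_col ?M) \<and> vnorm x \<le> 1} \<noteq> {}"
    by (auto intro!: exI[of _ "0\<^sub>v n"] simp: vnorm_eq)
  fix z assume "z \<in> {vnorm (?M *\<^sub>v x) |x. x \<in> carrier_vec (dim_col ?M) \<and> vnorm x \<le> 1}"
  then obtain x where x: "z = vnorm (?M *\<^sub>v x)" "x \<in> carrier_vec n" "vnorm x \<le> 1" by auto
  have "(\<Sum>j<d. ((?M *\<^sub>v x) $ j)\<^sup>2) = (\<Sum>j<d. (x $ t j)\<^sup>2)"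
    using x assms(2) by (intro sum.cong refl) (subst transpose_coord_embedding_mult_vec, auto)
  also have "\<dots> = (\<Sum>i\<in>t ` {..<d}. (x $ i)\<^sup>2)"
    using assms(1) by (simp add: sum.reindex)
  also have "\<dots> \<le> (\<Sum>i<n. (x $ i)\<^sup>2)"
    using assms(2) by (intro sum_mono2) auto
  finally have "vnorm (?M *\<^sub>v x) \<le> vnorm x"
    using x(2) by (simp add: vnorm_eq)
  thus "z \<le> 1" using x by simp
qed

text \<open>The fitted vector is the restriction of \<open>b\<close> to the image of
  \<open>t\<close>, so the residual vanishes there. This is why the entries of \<open>b\<close> on
  the image may be made as large as desired.\<close>

lemma vnorm_coord_embedding_residual_le:
  assumes t: "inj_on t {..<d}" "t ` {..<d} \<subseteq> {..<n}"
    and b: "b \<in> carrier_vec n" "\<And>i. i < n \<Longrightarrow> i \<notin> t ` {..<d} \<Longrightarrow> \<bar>b $ i\<bar> \<le> 1"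
  shows "vnorm (coord_embedding n d t *\<^sub>v (pinv (coord_embedding n d t) *\<^sub>v b) - b) \<le> sqrt (real n)"
proof -
  let ?A = "coord_embedding n d t"
  let ?x = "?A\<^sup>T *\<^sub>v b"
  have "((?A *\<^sub>v ?x - b) $ i)\<^sup>2 \<le> 1" if i: "i < n" for i
  proof -
    have "(?A *\<^sub>v ?x) $ i = (\<Sum>j = 0..<d. (if i = t j then 1 else 0) * ?x $ j)"
      using i by (simp add: scalar_prod_def coord_embedding_def)
    also have "\<dots> = (\<Sum>j<d. if i = t j then b $ i else 0)"
      unfolding atLeast0LessThan using t b i
      by (intro sum.cong refl) (auto simp: transpose_coord_embedding_mult_vec simp del: index_mult_mat_vec)
    finally have Ax: "(?A *\<^sub>v ?x) $ i = (\<Sum>j<d. if i = t j then b $ i else 0)" .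
    show ?thesis
    proof (cases "i \<in> t ` {..<d}")
      case True
      then obtain j where j: "j < d" "i = t j" by auto
      have "(\<Sum>j'<d. if i = t j' then b $ i else 0) = (\<Sum>j'<d. if j' = j then b $ i else 0)"
        using j t(1) by (intro sum.cong refl) (auto simp: inj_on_def)
      thus ?thesis using Ax i b(1) j by simp
    next
      case False
      hence "(\<Sum>j<d. if i = t j then b $ i else 0) = 0"
        by (intro sum.neutral) auto
      thus ?thesis using Ax i b(1) b(2)[OF i False] by (simp add: abs_square_le_1)
    qed
  qed
  hence "(\<Sum>i<n. ((?A *\<^sub>v ?x - b) $ i)\<^sup>2) \<le> (\<Sum>i<n. 1)"
    by (intro sum_mono) simp
  thus ?thesis
    using b(1) by (simp add: vnorm_eq pinv_coord_embedding[OF t])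
qed

section \<open>Lower bound for the error matrix\<close>

text \<open>If \<open>r \<le> d / 2\<close>, the term \<open>R2 * (d - r)\<close> suffices.
  Otherwise \<open>8 * m \<le> n\<close> gives \<open>\<tau> \<le> d / 4\<close>, so
  \<open>F * \<tau> \<ge> r * (r - \<tau>) \<ge> d\<^sup>2 / 8\<close>, and the upper bounds on
  \<open>\<tau>\<close> and \<open>m\<close> turn this into a lower bound for
  \<open>F\<close>.\<close>

lemma error_matrix_arith:
  fixes r \<tau> F \<eta> n m d R2 :: real
  assumes "r\<^sup>2 \<le> (r + F) * \<tau>" "r \<le> d" "0 \<le> F" "0 < d" "0 < n" "0 \<le> m" "0 < \<eta>"
    and \<tau>: "0 \<le> \<tau>" "\<tau> * n \<le> 2 * d * m" and m: "8 * m \<le> n" "64 * \<eta>\<^sup>2 * m \<le> d"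
    and R2: "8 * \<eta>\<^sup>2 * n \<le> R2 * d"
  shows "4 * \<eta>\<^sup>2 * n \<le> R2 * (d - r) + F"
proof (cases "r \<le> d / 2")
  case True
  have "0 \<le> R2 * d" using R2 assms by (smt (verit) mult_nonneg_nonneg zero_le_power2)
  hence "R2 \<ge> 0" using assms by (simp add: zero_le_mult_iff)
  hence "R2 * (d / 2) \<le> R2 * (d - r)" using True by (intro mult_left_mono) auto
  thus ?thesis using R2 assms by simp
next
  case False
  hence r: "r > d / 2" by simp
  have R2': "0 \<le> R2"
    using R2 assms by (smt (verit) mult_nonneg_nonneg zero_le_power2 zero_le_mult_iff)
  have "8 * (d * m) \<le> d * n" using mult_left_mono[OF m(1), of d] \<open>0 < d\<close> by (simp add: mult.left_commute)
  moreover have "\<tau> * n \<le> 2 * (d * m)" using \<tau>(2) by (simp add: mult.assoc)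
  ultimately have "\<tau> * n \<le> d / 4 * n" by simp
  hence \<tau>4: "\<tau> \<le> d / 4" using \<open>0 < n\<close> by (rule mult_right_le_imp_le)
  have "\<tau> \<noteq> 0" using assms r by auto
  hence \<tau>0: "\<tau> > 0" using \<tau> by simp
  have "d / 2 * (d / 4) \<le> r * (r - \<tau>)" using r \<tau>4 assms by (intro mult_mono) auto
  also have "\<dots> \<le> F * \<tau>" using assms by (simp add: power2_eq_square algebra_simps)
  finally have F: "d\<^sup>2 / 8 \<le> F * \<tau>" by (simp add: power2_eq_square)
  have "4 * \<eta>\<^sup>2 * n * \<tau> = 4 * \<eta>\<^sup>2 * (\<tau> * n)" by simp
  also have "\<dots> \<le> 4 * \<eta>\<^sup>2 * (2 * d * m)" using \<tau>(2) by (intro mult_left_mono) auto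
  also have "\<dots> = d * (64 * \<eta>\<^sup>2 * m) / 8" by simp
  also have "\<dots> \<le> d * d / 8" using m(2) assms by (intro divide_right_mono mult_left_mono) auto
  also have "\<dots> \<le> F * \<tau>" using F by (simp add: power2_eq_square)
  finally have "4 * \<eta>\<^sup>2 * n \<le> F" using \<tau>0 by simp
  moreover have "0 \<le> R2 * (d - r)" using R2' assms by simp
  ultimately show ?thesis by linarith
qed

text \<open>By the second moment identity, the weighted sum is the mean over random signs of the
  squared error, for a vector \<open>b\<close> with entries of size \<open>R\<close> on the chosen
  coordinates and 1 elsewhere.\<close>

lemma error_matrix_lower_bound:
  fixes S :: "real mat" and \<eta> R :: real
  assumes S: "S \<in> carrier_mat m n" and t: "inj_on t {..<d}" "t ` {..<d} \<subseteq> {..<n}"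
    and "0 < d" "0 < \<eta>" and m: "8 * real m \<le> real n" "64 * \<eta>\<^sup>2 * real m \<le> real d"
    and R: "R\<^sup>2 = 8 * \<eta>\<^sup>2 * real n"
    and \<tau>: "(\<Sum>j<d. (pinv S * S) $$ (t j, t j)) * real n \<le> 2 * real d * real m"
  defines "A \<equiv> coord_embedding n d t"
  defines "Y \<equiv> pinv (S * A) * S - A\<^sup>T"
  shows "4 * \<eta>\<^sup>2 * real n
    \<le> (\<Sum>a<d. \<Sum>i<n. ((if i \<in> t ` {..<d} then R else 1) * Y $$ (a, i))\<^sup>2)"
proof -
  let ?T = "t ` {..<d}"
  have tn: "t j < n" if "j < d" for j using t that by auto
  have n: "0 < n" using tn[OF \<open>0 < d\<close>] by simp
  have A: "A \<in> carrier_mat n d" by (simp add: A_def)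
  have SA: "S * A \<in> carrier_mat m d" using S A by simp
  define X where "X = pinv (S * A) * S"
  define P where "P = pinv (S * A) * (S * A)"
  define Q where "Q = pinv S * S"
  have pc: "pinv (S * A) \<in> carrier_mat d m" using pinv_carrier[of "S * A"] S A by simp
  have X: "X \<in> carrier_mat d n" using pc S by (simp add: X_def)
  have P: "P \<in> carrier_mat d d" "P\<^sup>T = P" "P * P = P"
    unfolding P_def by (rule pinv_mult_projection[OF SA])+
  have Q: "Q \<in> carrier_mat n n" "Q\<^sup>T = Q" "Q * Q = Q" "S * Q = S"
    unfolding Q_def by (rule pinv_mult_projection[OF S])+
  have XA: "X * A = P" using pc S A by (simp add: X_def P_def mat_assoc)
  have XQ: "X * Q = X" using pc S Q(1) by (simp add: X_def mat_assoc Q(4))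
  have Xt: "X $$ (a, t j) = P $$ (a, j)" if "a < d" "j < d" for a j
  proof -
    have "(X * A) $$ (a, j) = X $$ (a, t j)"
      unfolding A_def using X that tn by (intro mult_coord_embedding) auto
    thus ?thesis by (simp only: XA)
  qed
  define r where "r = (\<Sum>a<d. P $$ (a, a))"
  define F where "F = (\<Sum>a<d. \<Sum>i\<in>{..<n} - ?T. (X $$ (a, i))\<^sup>2)"
  define \<tau>' where "\<tau>' = (\<Sum>j<d. Q $$ (t j, t j))"
  have split: "(\<Sum>i<n. g i) = (\<Sum>j<d. g (t j)) + (\<Sum>i\<in>{..<n} - ?T. g i)" for g :: "nat \<Rightarrow> real"
    using sum.subset_diff[OF t(2), of g] t(1) by (simp add: sum.reindex add.commute)
  have r2: "r = (\<Sum>a<d. \<Sum>j<d. (P $$ (a, j))\<^sup>2)"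
    unfolding r_def by (intro sum.cong refl symmetric_idempotent_diag(1)[OF P]) simp
  \<comment> \<open>The columns of \<open>X\<close> in \<open>?T\<close> form
    \<open>X * A = P\<close>, a projection, whose squared Frobenius norm equals its trace
    \<open>r\<close>.\<close>
  have XF: "(\<Sum>a<d. \<Sum>i<n. (X $$ (a, i))\<^sup>2) = r + F"
    unfolding split r2 F_def sum.distrib by (simp add: Xt)
  have QF: "(\<Sum>a<d. \<Sum>i<n. (Q $$ (i, t a))\<^sup>2) = \<tau>'"
    unfolding \<tau>'_def
  proof (intro sum.cong refl)
    fix a assume "a \<in> {..<d}"
    hence a: "t a < n" by (simp add: tn)
    have "Q $$ (i, t a) = Q $$ (t a, i)" if "i < n" for i
      using Q(1) a that index_transpose_mat(1)[of "t a" Q i] by (simp add: Q(2))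
    thus "(\<Sum>i<n. (Q $$ (i, t a))\<^sup>2) = Q $$ (t a, t a)"
      unfolding symmetric_idempotent_diag(1)[OF Q(1-3) a] by simp
  qed
  have "r = (\<Sum>a<d. \<Sum>i<n. X $$ (a, i) * Q $$ (i, t a))"
    unfolding r_def
  proof (intro sum.cong refl)
    fix a assume a: "a \<in> {..<d}"
    have "P $$ (a, a) = (X * Q) $$ (a, t a)" unfolding XQ using a by (simp add: Xt)
    also have "\<dots> = (\<Sum>i<n. X $$ (a, i) * Q $$ (i, t a))"
      using a X Q(1) tn by (simp add: scalar_prod_def atLeast0LessThan)
    finally show "P $$ (a, a) = (\<Sum>i<n. X $$ (a, i) * Q $$ (i, t a))" .
  qed
  \<comment> \<open>One Cauchy--Schwarz over all index pairs \<open>(a, i)\<close>, that is, for the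
    Frobenius inner product.\<close>
  hence "r\<^sup>2 = (\<Sum>(a, i)\<in>{..<d} \<times> {..<n}. X $$ (a, i) * Q $$ (i, t a))\<^sup>2"
    by (simp add: sum.cartesian_product)
  also have "\<dots> \<le> (\<Sum>(a, i)\<in>{..<d} \<times> {..<n}. (X $$ (a, i))\<^sup>2)
      * (\<Sum>(a, i)\<in>{..<d} \<times> {..<n}. (Q $$ (i, t a))\<^sup>2)"
    unfolding split_def by (rule Cauchy_Schwarz_ineq_sum)
  also have "\<dots> = (r + F) * \<tau>'"
    by (simp add: XF[symmetric] QF[symmetric] sum.cartesian_product)
  finally have CS: "r\<^sup>2 \<le> (r + F) * \<tau>'" .
  have "r \<le> (\<Sum>a<d. 1)"
    unfolding r_def by (intro sum_mono symmetric_idempotent_diag(2)[OF P]) simp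
  hence rd: "r \<le> real d" by simp
  have Yt: "Y $$ (a, t j) = P $$ (a, j) - (if a = j then 1 else 0)" if "a < d" "j < d" for a j
  proof -
    have "A\<^sup>T $$ (a, t j) = (if a = j then 1 else 0)"
      using that tn t(1) by (auto simp: A_def coord_embedding_def inj_on_def)
    thus ?thesis
      using that tn X A by (simp add: Y_def X_def[symmetric] Xt)
  qed
  have Yn: "Y $$ (a, i) = X $$ (a, i)" if "a < d" "i < n" "i \<notin> ?T" for a i
  proof -
    have "A\<^sup>T $$ (a, i) = 0" using that by (auto simp: A_def coord_embedding_def)
    thus ?thesis using that X A by (simp add: Y_def X_def[symmetric])
  qed
  \<comment> \<open>On the columns in \<open>?T\<close>, \<open>Y\<close> is \<open>P\<close> minus
    the identity; its squared Frobenius norm is \<open>r + (d - 2 * r)\<close>.\<close>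
  have "(\<Sum>a<d. \<Sum>j<d. (Y $$ (a, t j))\<^sup>2)
      = (\<Sum>a<d. \<Sum>j<d. (P $$ (a, j))\<^sup>2 + (if a = j then 1 - 2 * P $$ (a, j) else 0))"
    by (intro sum.cong refl) (auto simp: Yt power2_diff)
  also have "\<dots> = r + (\<Sum>a<d. 1 - 2 * P $$ (a, a))"
    by (simp add: sum.distrib r2)
  also have "\<dots> = real d - r"
    by (simp add: sum_subtractf r_def flip: sum_distrib_left)
  finally have YT: "(\<Sum>a<d. \<Sum>j<d. (Y $$ (a, t j))\<^sup>2) = real d - r" .
  have "(\<Sum>a<d. \<Sum>i<n. ((if i \<in> ?T then R else 1) * Y $$ (a, i))\<^sup>2)
      = R\<^sup>2 * (\<Sum>a<d. \<Sum>j<d. (Y $$ (a, t j))\<^sup>2) + F"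
    unfolding split F_def sum.distrib by (simp add: power_mult_distrib sum_distrib_left Yn)
  also have "\<dots> = R\<^sup>2 * (real d - r) + F" by (simp only: YT)
  also have "\<dots> \<ge> 4 * \<eta>\<^sup>2 * real n"
  proof (rule error_matrix_arith[OF CS rd _ _ _ _ \<open>0 < \<eta>\<close> _ _ m])
    show "0 \<le> F" by (simp add: F_def sum_nonneg)
    show "0 \<le> \<tau>'" unfolding QF[symmetric] by (simp add: sum_nonneg)
    show "\<tau>' * real n \<le> 2 * real d * real m" using \<tau> by (simp add: \<tau>'_def Q_def)
    show "8 * \<eta>\<^sup>2 * real n \<le> R\<^sup>2 * real d"
      unfolding R using mult_left_mono[of 1 "real d" "8 * \<eta>\<^sup>2 * real n"] \<open>0 < d\<close> by simp
  qed (use n \<open>0 < d\<close> in auto)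
  finally show ?thesis .
qed

text \<open>Measurability of the events need not be assumed: a non-measurable set has measure \<open>0 < p\<close>.\<close>

lemma (in prob_space) card_good_events:
  assumes "finite J" "0 < p" "\<And>j. j \<in> J \<Longrightarrow> p \<le> prob (G j)"
    and le: "\<And>x. x \<in> space M \<Longrightarrow> real (card {j \<in> J. x \<in> G j}) \<le> q"
  shows "p * real (card J) \<le> q"
proof -
  have G: "G j \<in> events" if "j \<in> J" for j
    using assms(2) assms(3)[OF that] measure_notin_sets[of "G j" M] by fastforce
  have int: "integrable M (\<lambda>x. indicator (G j) x :: real)" if "j \<in> J" for j
    using G[OF that] by (intro integrable_real_indicator) (simp_all add: less_top[symmetric])
  \<comment> \<open>Double counting: the sum of the probabilities is the expected number of events
    that occur, and this number is at most \<open>q\<close> everywhere.\<close>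
  have "p * real (card J) \<le> (\<Sum>j\<in>J. prob (G j))"
    using sum_mono[of J "\<lambda>_. p" "\<lambda>j. prob (G j)"] assms by (simp add: mult.commute)
  also have "\<dots> = (\<Sum>j\<in>J. \<integral>x. indicator (G j) x \<partial>M)"
    using G by (intro sum.cong) (auto simp: sets.Int_space_eq2)
  also have "\<dots> = (\<integral>x. (\<Sum>j\<in>J. indicator (G j) x) \<partial>M)"
    using int by (intro Bochner_Integration.integral_sum[symmetric])
  also have "\<dots> \<le> (\<integral>x. q \<partial>M)"
  proof (rule integral_mono)
    show "integrable M (\<lambda>x. \<Sum>j\<in>J. indicator (G j) x :: real)"
      using int by (intro Bochner_Integration.integrable_sum)
    fix x assume "x \<in> space M"
    moreover have "(\<Sum>j\<in>J. indicator (G j) x :: real) = real (card {j \<in> J. x \<in> G j})"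
      using assms(1) by (simp add: indicator_def sum.If_cases Int_def)
    ultimately show "(\<Sum>j\<in>J. indicator (G j) x :: real) \<le> q" using le by simp
  qed simp
  finally show ?thesis by (simp add: prob_space)
qed

section \<open>Averaging over cyclic intervals\<close>

lemma inj_on_mod_shift:
  assumes "d \<le> n"
  shows "inj_on (\<lambda>j. (k + j) mod n) {..<d::nat}"
proof -
  have "i = j" if "i \<le> j" "j < n" "(k + j) mod n = (k + i) mod n" for i j
  proof -
    have "n dvd (k + j) - (k + i)" using that mod_eq_dvd_iff_nat[of "k + i" "k + j" n] by simp
    thus ?thesis using that by (auto dest!: dvd_imp_le)
  qed
  thus ?thesis using assms by (intro inj_onI) (metis lessThan_iff nat_le_linear order_less_le_trans)
qed

lemma sum_mod_shift:
  fixes f :: "nat \<Rightarrow> 'a::comm_monoid_add"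
  shows "(\<Sum>k<n. f ((k + j) mod n)) = (\<Sum>k<n. f k)"
proof (cases "n = 0")
  case False
  have inj: "inj_on (\<lambda>k. (k + j) mod n) {..<n}"
    using inj_on_mod_shift[of n n j] by (simp add: add.commute)
  moreover have "(\<lambda>k. (k + j) mod n) ` {..<n} \<subseteq> {..<n}" using False by auto
  ultimately have "(\<lambda>k. (k + j) mod n) ` {..<n} = {..<n}"
    by (simp add: endo_inj_surj)
  thus ?thesis using sum.reindex[OF inj, of f] by simp
qed simp

text \<open>Markov's inequality: summing over all shifts counts every coordinate \<open>d\<close>
  times, so the interval sums have mean at most \<open>d * m / n\<close>, and at most half of them
  exceed twice that value.\<close>

lemma card_small_shift:
  fixes q :: "nat \<Rightarrow> real"
  assumes "0 < d" and q: "\<And>i. i < n \<Longrightarrow> 0 \<le> q i" "(\<Sum>i<n. q i) \<le> real m"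
  shows "n \<le> 2 * card {k. k < n \<and> (\<Sum>j<d. q ((k + j) mod n)) * real n \<le> 2 * real d * real m}"
proof -
  let ?\<tau> = "\<lambda>k. \<Sum>j<d. q ((k + j) mod n)"
  let ?K = "{k. k < n \<and> ?\<tau> k * real n \<le> 2 * real d * real m}"
  let ?B = "{..<n} - ?K"
  have \<tau>0: "0 \<le> ?\<tau> k" if "k < n" for k using that q(1) by (intro sum_nonneg) auto
  have "(\<Sum>k<n. ?\<tau> k) = real d * (\<Sum>i<n. q i)"
    by (subst sum.swap) (simp add: sum_mod_shift)
  hence tot: "(\<Sum>k<n. ?\<tau> k) \<le> real d * real m" using q(2) by (simp add: mult_left_mono)
  have "2 * card ?B \<le> n"
  proof (rule ccontr)
    assume "\<not> 2 * card ?B \<le> n"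
    hence c: "n < 2 * card ?B" by simp
    hence "card ?B \<noteq> 0" by linarith
    hence ne: "?B \<noteq> {}" by (metis card.empty)
    have "real (card ?B) * (2 * real d * real m) = (\<Sum>k\<in>?B. 2 * real d * real m)" by simp
    \<comment> \<open>Strictness, available since \<open>?B\<close> is nonempty, yields the
      contradiction even for \<open>m = 0\<close>.\<close>
    also have "\<dots> < (\<Sum>k\<in>?B. ?\<tau> k * real n)"
      using ne by (intro sum_strict_mono) auto
    also have "\<dots> \<le> (\<Sum>k<n. ?\<tau> k * real n)"
      using \<tau>0 by (intro sum_mono2) auto
    also have "\<dots> \<le> real d * real m * real n"
      using tot by (simp add: mult_right_mono flip: sum_distrib_right)
    finally have "real d * real m * (2 * real (card ?B)) < real d * real m * real n" by (simp add: mult_ac)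
    moreover have "real d * real m * real n \<le> real d * real m * (2 * real (card ?B))"
      using c by (intro mult_left_mono) auto
    ultimately show False by simp
  qed
  moreover have "card ?B = n - card ?K" by (subst card_Diff_subset) auto
  ultimately show ?thesis by simp
qed

section \<open>The lower bound on the sketching dimension\<close>

lemma space_matrix_distribution:
  assumes "matrix_distribution m n \<mu>"
  shows "space \<mu> = carrier_mat m n"
  using assms sets_eq_imp_space_eq[of \<mu> "borel_mat m n"]
  by (simp add: matrix_distribution_def borel_mat_def)

text \<open>An instance is a pair of a shift \<open>k\<close> and a sign set \<open>F\<close>. Each
  instance succeeds with probability at least 19/20, while every fixed \<open>S\<close> succeeds on
  at most 29/32 of them.\<close>

lemma not_regression_guarantee_if_few_rows:
  assumes C: "C > 0" and \<epsilon>: "0 < \<epsilon>" and dn: "0 < d" "d \<le> n"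
    and \<mu>: "matrix_distribution m n \<mu>" and guarantee: "l2_regression_guarantee C \<epsilon> n d \<mu>"
    and m: "8 * real m \<le> real n" "64 * (C * \<epsilon>)\<^sup>2 * real m \<le> real d"
  shows False
proof -
  interpret prob_space \<mu> using \<mu> by (simp add: matrix_distribution_def)
  define \<eta> where "\<eta> = C * \<epsilon>"
  have \<eta>: "0 < \<eta>" using C \<epsilon> by (simp add: \<eta>_def)
  have n: "0 < n" using dn by simp
  \<comment> \<open>As \<open>d \<ge> 1\<close>, this gives
    \<open>R\<^sup>2 * d / 2 \<ge> 4 * \<eta>\<^sup>2 * n\<close>, enough to rule out success
    through a projection of rank at most \<open>d / 2\<close>.\<close>
  define R where "R = sqrt (8 * \<eta>\<^sup>2 * real n)"
  have R: "R\<^sup>2 = 8 * \<eta>\<^sup>2 * real n" by (simp add: R_def)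
  define t where "t = (\<lambda>k j. (k + j) mod n)"
  have t: "inj_on (t k) {..<d}" "t k ` {..<d} \<subseteq> {..<n}" for k
    using inj_on_mod_shift[OF dn(2), of k] n by (auto simp: t_def)
  define A where "A = (\<lambda>k. coord_embedding n d (t k))"
  define w where "w = (\<lambda>k i. if i \<in> t k ` {..<d} then R else 1)"
  define b where "b = (\<lambda>k F. vec n (\<lambda>i. w k i * sgn_at F i))"
  define G where "G = (\<lambda>(k, F). {S \<in> space \<mu>.
     vnorm (pinv (S * A k) *\<^sub>v (S *\<^sub>v b k F) - pinv (A k) *\<^sub>v b k F)
       \<le> C * (\<epsilon> * spectral_norm (pinv (A k)) * vnorm (A k *\<^sub>v (pinv (A k) *\<^sub>v b k F) - b k F))})"
  define J where "J = {..<n} \<times> Pow {..<n}"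
  have space: "space \<mu> = carrier_mat m n" by (rule space_matrix_distribution[OF \<mu>])
  have prob: "19 / 20 \<le> prob (G j)" if "j \<in> J" for j
    using guarantee by (cases j) (auto simp: l2_regression_guarantee_def Let_def G_def A_def b_def)
  have bad: "16 * card {F \<in> Pow {..<n}. S \<in> G (k, F)} \<le> 13 * 2 ^ n"
    if S: "S \<in> carrier_mat m n"
      and k: "(\<Sum>j<d. (pinv S * S) $$ (t k j, t k j)) * real n \<le> 2 * real d * real m" for S k
  proof -
    define Y where "Y = pinv (S * A k) * S - (A k)\<^sup>T"
    define v where "v = (\<lambda>a i. w k i * Y $$ (a, i))"
    have pc: "pinv (S * A k) \<in> carrier_mat d m"
      using pinv_carrier[of "S * A k"] S by (simp add: A_def)
    have Y: "Y \<in> carrier_mat d n" using pc S unfolding Y_def A_def by (intro minus_carrier_mat) simp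
    have E: "4 * \<eta>\<^sup>2 * real n \<le> (\<Sum>a<d. \<Sum>i<n. (v a i)\<^sup>2)"
      unfolding v_def w_def Y_def A_def
      by (rule error_matrix_lower_bound[OF S t dn(1) \<eta> m(1) _ R k])
         (use m(2) in \<open>simp add: \<eta>_def\<close>)
    have Epos: "0 < (\<Sum>a<d. \<Sum>i<n. (v a i)\<^sup>2)"
      by (rule less_le_trans[OF _ E]) (use \<eta> n in simp)
    \<comment> \<open>Success bounds the squared error by \<open>\<eta>\<^sup>2 * n\<close>, at most
      a quarter of its mean by \<open>E\<close>. The successes thus avoid the Paley--Zygmund event,
      which leaves at most 13/16 of the sign sets.\<close>
    have "(\<Sum>a<d. (\<Sum>i<n. sgn_at F i * v a i)\<^sup>2) \<le> (\<Sum>a<d. \<Sum>i<n. (v a i)\<^sup>2) / 4"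
      if F: "S \<in> G (k, F)" for F
    proof -
      have bc: "b k F \<in> carrier_vec n" by (simp add: b_def)
      have "pinv (S * A k) *\<^sub>v (S *\<^sub>v b k F) - pinv (A k) *\<^sub>v b k F = Y *\<^sub>v b k F"
        using pc S bc unfolding Y_def A_def pinv_coord_embedding[OF t]
        by (subst minus_mult_distrib_mat_vec[of _ d n]) (auto simp: assoc_mult_mat_vec[of _ d m _ n])
      moreover have "vnorm (Y *\<^sub>v b k F) = sqrt (\<Sum>a<d. (\<Sum>i<n. sgn_at F i * v a i)\<^sup>2)"
        using Y unfolding vnorm_eq
        by (intro arg_cong[of _ _ sqrt] sum.cong arg_cong[of _ _ "\<lambda>x. x\<^sup>2"])
           (auto simp: scalar_prod_def b_def v_def atLeast0LessThan mult_ac)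
      moreover have "spectral_norm (pinv (A k)) * vnorm (A k *\<^sub>v (pinv (A k) *\<^sub>v b k F) - b k F)
          \<le> 1 * sqrt (real n)"
      proof (rule mult_mono)
        show "spectral_norm (pinv (A k)) \<le> 1"
          unfolding A_def by (rule spectral_norm_pinv_coord_embedding_le[OF t])
        show "vnorm (A k *\<^sub>v (pinv (A k) *\<^sub>v b k F) - b k F) \<le> sqrt (real n)"
          unfolding A_def by (rule vnorm_coord_embedding_residual_le[OF t bc])
            (simp add: b_def w_def sgn_at_def)
      qed (simp_all add: vnorm_eq sum_nonneg)
      hence "C * (\<epsilon> * spectral_norm (pinv (A k)) * vnorm (A k *\<^sub>v (pinv (A k) *\<^sub>v b k F) - b k F))
          \<le> \<eta> * sqrt (real n)"
        using C \<epsilon> by (simp add: \<eta>_def mult.assoc)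
      ultimately have "sqrt (\<Sum>a<d. (\<Sum>i<n. sgn_at F i * v a i)\<^sup>2) \<le> sqrt (\<eta>\<^sup>2 * real n)"
        using F \<eta> by (simp add: G_def real_sqrt_mult)
      thus ?thesis using E by simp
    qed
    hence "{F \<in> Pow {..<n}. S \<in> G (k, F)}
        \<subseteq> Pow {..<n} - {F \<in> Pow {..<n}. (\<Sum>a<d. (\<Sum>i<n. sgn_at F i * v a i)\<^sup>2) > (\<Sum>a<d. \<Sum>i<n. (v a i)\<^sup>2) / 4}"
      (is "_ \<subseteq> _ - ?B") by force
    hence "card {F \<in> Pow {..<n}. S \<in> G (k, F)} \<le> card (Pow {..<n} - ?B)"
      by (intro card_mono) auto
    also have "\<dots> = 2 ^ n - card ?B"
      by (subst card_Diff_subset) (auto simp: card_Pow intro: finite_subset[of _ "Pow {..<n}"])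
    finally show ?thesis
      using random_signs_anticoncentration[of "{..<n}" v "{..<d}", OF _ Epos] by simp
  qed
  \<comment> \<open>At least half of the shifts lose 3/16 of their sign sets, and 1 - 1/2 * 3/16 =
    29/32 < 19/20.\<close>
  have "19 / 20 * real (card J) \<le> 29 / 32 * (real n * 2 ^ n)"
  proof (rule card_good_events[of J _ G])
    fix S assume "S \<in> space \<mu>"
    hence S: "S \<in> carrier_mat m n" by (simp add: space)
    let ?K = "{k. k < n \<and> (\<Sum>j<d. (pinv S * S) $$ (t k j, t k j)) * real n \<le> 2 * real d * real m}"
    have q0: "0 \<le> (pinv S * S) $$ (i, i)" if "i < n" for i
      unfolding symmetric_idempotent_diag(1)[OF pinv_mult_projection(1-3)[OF S] that]
      by (simp add: sum_nonneg)
    have K: "n \<le> 2 * card ?K"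
      unfolding t_def
      by (rule card_small_shift[of d n "\<lambda>i. (pinv S * S) $$ (i, i)", OF dn(1) q0 trace_pinv_mult_le[OF S]])
    have "{j \<in> J. S \<in> G j} = Sigma {..<n} (\<lambda>k. {F \<in> Pow {..<n}. S \<in> G (k, F)})"
      by (auto simp: J_def)
    hence "real (card {j \<in> J. S \<in> G j}) = (\<Sum>k<n. real (card {F \<in> Pow {..<n}. S \<in> G (k, F)}))"
      by (simp add: card_SigmaI)
    also have "\<dots> \<le> (\<Sum>k<n. 2 ^ n - (if k \<in> ?K then 3 / 16 * 2 ^ n else 0))"
    proof (rule sum_mono)
      fix k assume k: "k \<in> {..<n}"
      have "card {F \<in> Pow {..<n}. S \<in> G (k, F)} \<le> card (Pow {..<n})"
        by (intro card_mono) auto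
      hence "real (card {F \<in> Pow {..<n}. S \<in> G (k, F)}) \<le> 2 ^ n"
        by (simp add: card_Pow of_nat_le_numeral_power_cancel_iff del: of_nat_le_iff)
      moreover have "16 * real (card {F \<in> Pow {..<n}. S \<in> G (k, F)}) \<le> 13 * 2 ^ n" if "k \<in> ?K"
        using of_nat_mono[OF bad[OF S, of k], where 'a = real] that by simp
      ultimately show "real (card {F \<in> Pow {..<n}. S \<in> G (k, F)})
          \<le> 2 ^ n - (if k \<in> ?K then 3 / 16 * 2 ^ n else 0)"
        by (auto split: if_splits)
    qed
    also have "\<dots> = real n * 2 ^ n - real (card ?K) * (3 / 16 * 2 ^ n)"
    proof -
      have *: "(\<Sum>k<n. 2 ^ n - (if k \<in> K then e else 0)) = real n * 2 ^ n - real (card K) * e"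
        if "K \<subseteq> {..<n}" for K :: "nat set" and e :: real
        using Int_absorb1[OF that] by (simp add: sum_subtractf sum.If_cases)
      show ?thesis by (rule *) auto
    qed
    also have "\<dots> \<le> real n * 2 ^ n - (real n / 2) * (3 / 16 * 2 ^ n)"
      using K by (intro diff_left_mono mult_right_mono) auto
    also have "\<dots> = 29 / 32 * (real n * 2 ^ n)" by simp
    finally show "real (card {j \<in> J. S \<in> G j}) \<le> 29 / 32 * (real n * 2 ^ n)" .
  qed (use prob in \<open>auto simp: J_def\<close>)
  moreover have "real (card J) = real n * 2 ^ n"
    by (simp add: J_def card_cartesian_product card_Pow)
  ultimately show False using n by simp
qed

theorem theorem14:
  fixes C :: real
  assumes "C > 0"
  shows "\<exists>c > 0. \<forall>(\<epsilon>::real) (m::nat) (n::nat) (d::nat) (\<mu> :: real Matrix.mat measure).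
           0 < \<epsilon> \<and> \<epsilon> < 1 \<and> n \<ge> d \<and>
           matrix_distribution m n \<mu> \<and>
           l2_regression_guarantee C \<epsilon> n d \<mu>
           \<longrightarrow> real m \<ge> c * min (real n) (real d / \<epsilon>\<^sup>2)"
proof -
  \<comment> \<open>The two entries correspond to the thresholds \<open>m \<le> n / 8\<close> and
    \<open>m \<le> d / (64 * (C * \<epsilon>)\<^sup>2)\<close> below which the guarantee is
    impossible.\<close>
  define c where "c = min (1 / 8) (1 / (64 * C\<^sup>2))"
  have c: "0 < c" "c \<le> 1 / 8" "c \<le> 1 / (64 * C\<^sup>2)" using assms by (auto simp: c_def)
  have "real m \<ge> c * min (real n) (real d / \<epsilon>\<^sup>2)"
    if \<epsilon>: "0 < \<epsilon>" and dn: "d \<le> n" and \<mu>: "matrix_distribution m n \<mu>"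
      and g: "l2_regression_guarantee C \<epsilon> n d \<mu>" for \<epsilon> m n d \<mu>
  proof (rule ccontr)
    assume "\<not> real m \<ge> c * min (real n) (real d / \<epsilon>\<^sup>2)"
    hence less: "real m < c * min (real n) (real d / \<epsilon>\<^sup>2)" by simp
    \<comment> \<open>For \<open>d = 0\<close> the minimum is 0, and \<open>m\<close> would have to
      be negative.\<close>
    have d: "0 < d" using less by (cases "d = 0") auto
    have "c * min (real n) (real d / \<epsilon>\<^sup>2) \<le> 1 / 8 * real n"
      using c by (intro mult_mono) auto
    hence m1: "8 * real m \<le> real n" using less by simp
    have "c * min (real n) (real d / \<epsilon>\<^sup>2) \<le> 1 / (64 * C\<^sup>2) * (real d / \<epsilon>\<^sup>2)"
      using c by (intro mult_mono) auto
    hence "real m \<le> real d / (64 * (C * \<epsilon>)\<^sup>2)" using less by (simp add: power_mult_distrib)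
    hence m2: "64 * (C * \<epsilon>)\<^sup>2 * real m \<le> real d"
      using assms \<epsilon> by (simp add: pos_le_divide_eq mult.commute)
    show False
      by (rule not_regression_guarantee_if_few_rows[OF assms \<epsilon> d dn \<mu> g m1 m2])
  qed
  thus ?thesis using c(1) by blast
qed

end
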